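(* Let $\mathbb{K}$ be either $\mathbb{R}$ or $\mathbb{C}$. Then every convex compact subset of $\mathbb{K}^n$ with nonempty interior in $\mathbb{K}^n$, regarded as a subset of $\mathbb{C}^n$, has the local $1/2$-Hölder continuity property of order $1/2$.
   Context: $\mathbb{R}^n$ is regarded as a subset of $\mathbb{C}^n$ in the standard way. $\mathcal{L}$ is the set of plurisubharmonic functions $u$ on $\mathbb{C}^n$ for which there is a constant $c_u$ with $u(z)\le\max\{0,\log\|z\|\}+c_u$ for all $z\in\mathbb{C}^n$. For $E\subset\mathbb{C}^n$, $L_E(z)=\sup\{u(z):u\in\mathcal{L},\ u|_E\le0\}$, and for $a\in E$, $\varpi_E(a,\delta)=\sup_{\|z-a\|\le\delta}L_E(z)\in[0,\infty]$. $\bar{\mathbb{B}}(a,r)$ is the closed Euclidean ball in $\mathbb{C}^n$. For $q>0$, $\mu\in(0,1]$, a compact $F\subset\mathbb{C}^n$ has the local $\mu$-Hölder continuity property of order $q$ if there is $C>0$ with $\varpi_{F\cap\bar{\mathbb{B}}(a,r)}(a,\delta)\le C\delta^\mu/r^q$ for all $a\in F$, $0<\delta\le1$, $0<r\le1$. *)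

theory Defs
  imports "HOL-Analysis.Analysis"
begin

definition usc_on :: "'a::topological_space set \<Rightarrow> ('a \<Rightarrow> ereal) \<Rightarrow> bool" where
  "usc_on S u \<longleftrightarrow> (\<forall>t. openin (top_of_set S) {z \<in> S. u z < t})"

text \<open>Integral of an extended real function as positive part minus negative part (\<^const>\<open>e2ennreal\<close>
  maps negative values to 0).  It has its usual meaning unless both parts are infinite; that does
  not occur for an upper semicontinuous function with values below \<open>\<infinity>\<close> on a compact circle,
  because it is bounded above there.\<close>

definition ereal_integral :: "'a measure \<Rightarrow> ('a \<Rightarrow> ereal) \<Rightarrow> ereal" where
  "ereal_integral M f =
     enn2ereal (\<integral>\<^sup>+x. e2ennreal (f x) \<partial>M) - enn2ereal (\<integral>\<^sup>+x. e2ennreal (- f x) \<partial>M)"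

definition circle_mean :: "(complex \<Rightarrow> ereal) \<Rightarrow> complex \<Rightarrow> real \<Rightarrow> ereal" where
  "circle_mean u c r =
     ereal (1 / (2 * pi)) *
       ereal_integral (restrict_space lborel {0..2 * pi}) (\<lambda>\<theta>. u (c + of_real r * cis \<theta>))"

lemma circle_mean_real:
  assumes "integrable (restrict_space lborel {0..2 * pi}) (\<lambda>\<theta>. f (c + of_real r * cis \<theta>))"
  shows "circle_mean (\<lambda>z. ereal (f z)) c r =
    ereal (1 / (2 * pi) * integral\<^sup>L (restrict_space lborel {0..2 * pi}) (\<lambda>\<theta>. f (c + of_real r * cis \<theta>)))"
proof -
  let ?M = "restrict_space lborel {0..2 * pi}" and ?g = "\<lambda>\<theta>. f (c + of_real r * cis \<theta>)"
  have fin: "(\<integral>\<^sup>+x. ennreal (?g x) \<partial>?M) \<noteq> \<infinity>" "(\<integral>\<^sup>+x. ennreal (- ?g x) \<partial>?M) \<noteq> \<infinity>"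
    using assms real_integrable_def by blast+
  have e: "e2ennreal (ereal y) = ennreal y" for y
    by simp
  have "enn2ereal x - enn2ereal y = ereal (enn2real x - enn2real y)"
    if "x \<noteq> \<infinity>" "y \<noteq> \<infinity>" for x y
    using that by (cases x; cases y) auto
  then show ?thesis
    unfolding circle_mean_def ereal_integral_def real_lebesgue_integral_def[OF assms]
    using fin by (simp add: e)
qed

text \<open>In both definitions below the function that is identically \<open>-\<infinity>\<close> is admitted.  Excluding it
  would not change the extremal function, since the zero function is always a competitor.\<close>

definition subharmonic_on :: "complex set \<Rightarrow> (complex \<Rightarrow> ereal) \<Rightarrow> bool" where
  "subharmonic_on S u \<longleftrightarrow>
     open S \<and> (\<forall>z\<in>S. u z < \<infinity>) \<and> usc_on S u \<and>
     (\<forall>c r. 0 < r \<and> cball c r \<subseteq> S \<longrightarrow> u c \<le> circle_mean u c r)"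

definition plurisubharmonic_on :: "(complex ^ 'n) set \<Rightarrow> (complex ^ 'n \<Rightarrow> ereal) \<Rightarrow> bool" where
  "plurisubharmonic_on S u \<longleftrightarrow>
     open S \<and> (\<forall>z\<in>S. u z < \<infinity>) \<and> usc_on S u \<and>
     (\<forall>a b. subharmonic_on {l. a + l *s b \<in> S} (\<lambda>l. u (a + l *s b)))"

text \<open>\<open>ln 0 = 0\<close> in HOL, so the maximum below has the intended value 0 also at \<open>z = 0\<close>.\<close>

definition Lelong_class :: "(complex ^ 'n \<Rightarrow> ereal) set" where
  "Lelong_class =
     {u. plurisubharmonic_on UNIV u \<and>
         (\<exists>c::real. \<forall>z. u z \<le> ereal (max 0 (ln (norm z)) + c))}"

definition extremal_fun :: "(complex ^ 'n) set \<Rightarrow> complex ^ 'n \<Rightarrow> ereal" where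
  "extremal_fun E z = (SUP u \<in> {u \<in> Lelong_class. \<forall>w\<in>E. u w \<le> 0}. u z)"

definition extremal_modulus :: "(complex ^ 'n) set \<Rightarrow> complex ^ 'n \<Rightarrow> real \<Rightarrow> ereal" where
  "extremal_modulus E a \<delta> = (SUP z \<in> {z. norm (z - a) \<le> \<delta>}. extremal_fun E z)"

definition local_Holder_continuity_property :: "real \<Rightarrow> real \<Rightarrow> (complex ^ 'n) set \<Rightarrow> bool" where
  "local_Holder_continuity_property \<mu> q F \<longleftrightarrow>
     0 < \<mu> \<and> \<mu> \<le> 1 \<and> 0 < q \<and> compact F \<and>
     (\<exists>C>0. \<forall>a\<in>F. \<forall>\<delta> r. 0 < \<delta> \<and> \<delta> \<le> 1 \<and> 0 < r \<and> r \<le> 1 \<longrightarrow>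
        extremal_modulus (F \<inter> cball a r) a \<delta> \<le> ereal (C * \<delta> powr \<mu> / r powr q))"

definition complexify :: "real ^ 'n \<Rightarrow> complex ^ 'n" where
  "complexify x = (\<chi> i. of_real (x $ i))"

end

theory Submission
  imports Defs "HOL-Complex_Analysis.Cauchy_Integral_Formula"
begin

text \<open>The estimate reduces to cones.  A convex body contains, from each of its points \<open>a\<close>, a cone with
  vertex \<open>a\<close> whose size and opening are controlled uniformly in \<open>a\<close>, and a copy of it scaled by a multiple of \<open>r\<close> lies in
  the ball of radius \<open>r\<close> around \<open>a\<close>.  Since the Lelong class is invariant under real dilations and
  translations, it suffices to show \<open>u w \<le> A sqrt \<bar>w\<bar>\<close>, with a uniform \<open>A\<close>, for all competitors
  \<open>u\<close> that are nonpositive on a cone \<open>{\<tau> (v + p) | 0 \<le> \<tau> \<le> 1, \<bar>p\<bar> \<le> \<rho>}\<close> with \<open>\<bar>v\<bar> \<le> D\<close>; see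
  \<open>convex_local_Holder\<close>.  The vectors \<open>p\<close> range over \<open>\<real>\<^sup>n\<close> or over all of \<open>\<complex>\<^sup>n\<close>, and both cases are
  treated at once.

  Plurisubharmonicity is used on complex lines only, where \<open>u\<close> is compared with explicit harmonic
  functions by the maximum principle \<open>subharmonic_le_harmonic\<close>.  Three comparisons suffice: a bound
  linear in \<open>\<beta>\<close> at height \<open>\<beta>\<close> above a segment on which the function is nonpositive, a square root
  bound near the tip of a slit, and logarithmic growth outside a disc.

  The core is a self-improvement across scales, \<open>Lelong_class_sqrt_halving\<close>.  A point \<open>w\<close> of size
  \<open>\<epsilon>\<close> is joined to the interior of the cone by the complex line in the direction \<open>v\<close> of its axis.
  At the points \<open>w + t v\<close> with \<open>t \<ge> K \<epsilon>\<close> the cone has width comparable to \<open>t\<close>; if \<open>u\<close> is known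
  to be at most \<open>A sqrt t\<close> at that scale, the linear bound yields a multiple of \<open>A \<epsilon> / sqrt t\<close>,
  which is at most \<open>(A / 2) sqrt \<epsilon>\<close> when \<open>K\<close> is large.  The slit bound transports this back to
  \<open>w\<close> with an error \<open>O(sqrt (K \<epsilon>))\<close> that does not involve \<open>A\<close>.  Hence a sufficiently large \<open>A\<close>
  reproduces itself when the scale is halved.  The starting point is the uniform bound
  \<open>Lelong_class_le_log_real_ball\<close>, obtained by a similar contraction argument.\<close>

section \<open>The maximum principle against harmonic majorants\<close>

lemma usc_attains_sup:
  fixes f :: "'a::topological_space \<Rightarrow> ereal"
  assumes "compact S" "S \<noteq> {}" and usc: "usc_on S f"
  shows "\<exists>z\<in>S. \<forall>w\<in>S. f w \<le> f z"
proof (rule ccontr)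
  assume "\<not> ?thesis"
  then have "\<forall>z\<in>S. \<exists>t. f z < t \<and> (\<exists>w\<in>S. t < f w)"
    using ereal_dense2 by (meson not_le dense)
  then obtain t where t: "\<And>z. z \<in> S \<Longrightarrow> f z < t z" "\<And>z. z \<in> S \<Longrightarrow> \<exists>w\<in>S. t z < f w"
    by metis
  have "\<forall>z\<in>S. \<exists>U. open U \<and> {w \<in> S. f w < t z} = S \<inter> U"
    using usc unfolding usc_on_def openin_open by blast
  then obtain U where U: "\<And>z. z \<in> S \<Longrightarrow> open (U z)" "\<And>z. z \<in> S \<Longrightarrow> {w \<in> S. f w < t z} = S \<inter> U z"
    by metis
  have "S \<subseteq> (\<Union>z\<in>S. U z)"
    using U(2) t(1) by blast
  then obtain D where D: "D \<subseteq> S" "finite D" "S \<subseteq> (\<Union>z\<in>D. U z)"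
    using compactE_image[OF \<open>compact S\<close>] U(1) by metis
  then have "D \<noteq> {}"
    using \<open>S \<noteq> {}\<close> by auto
  then have "Max (t ` D) \<in> t ` D"
    using D(2) by simp
  then obtain z0 where z0: "z0 \<in> D" "t z0 = Max (t ` D)"
    by force
  obtain w where w: "w \<in> S" "t z0 < f w"
    using t(2) z0(1) D(1) by blast
  obtain z where z: "z \<in> D" "w \<in> U z"
    using D(3) w(1) by blast
  then have "f w < t z"
    using U(2) D(1) w(1) by blast
  also have "t z \<le> t z0"
    using z0(2) z(1) D(2) by simp
  finally show False
    using w(2) by simp
qed

lemma usc_on_minus_continuous:
  fixes u :: "'a::topological_space \<Rightarrow> ereal" and G :: "'a \<Rightarrow> real"
  assumes usc: "usc_on S u" and G: "continuous_on S G"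
  shows "usc_on S (\<lambda>z. u z - ereal (G z))"
  unfolding usc_on_def
proof
  fix t :: ereal
  have eq: "{z \<in> S. u z - ereal (G z) < t} =
      (\<Union>q::real. {z \<in> S. u z < ereal q} \<inter> (S \<inter> G -` {x. ereal q < t + ereal x}))" (is "?L = ?R")
  proof (intro set_eqI iffI)
    fix z assume "z \<in> ?L"
    then have z: "z \<in> S" "u z < t + ereal (G z)"
      by (auto simp: ereal_minus_less_iff)
    then obtain q where "u z < ereal q" "ereal q < t + ereal (G z)"
      using ereal_dense2 by blast
    with z show "z \<in> ?R" by auto
  next
    fix z assume "z \<in> ?R"
    then have "z \<in> S" "u z < t + ereal (G z)"
      by (auto intro: less_trans)
    then show "z \<in> ?L"
      by (auto simp: ereal_minus_less_iff)
  qed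
  have "open {x. ereal q < t + ereal x}" for q
  proof (cases t)
    case (real s)
    then have "{x. ereal q < t + ereal x} = {q - s<..}"
      by auto
    then show ?thesis by simp
  qed auto
  then have "openin (top_of_set S) (S \<inter> G -` {x. ereal q < t + ereal x})" for q
    using G continuous_openin_preimage_gen by blast
  moreover have "openin (top_of_set S) {z \<in> S. u z < ereal q}" for q
    using usc unfolding usc_on_def by blast
  ultimately show "openin (top_of_set S) {z \<in> S. u z - ereal (G z) < t}"
    unfolding eq by (intro openin_Union) auto
qed

text \<open>The extended integral is a difference of two nonnegative integrals, and a nonnegative integral
  is monotone for arbitrary functions.\<close>

lemma circle_mean_mono:
  assumes "\<And>\<theta>. u (c + of_real r * cis \<theta>) \<le> v (c + of_real r * cis \<theta>)"
  shows "circle_mean u c r \<le> circle_mean v c r"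
  unfolding circle_mean_def ereal_integral_def
  using assms
  by (intro ereal_mult_left_mono ereal_minus_mono)
     (auto intro!: nn_integral_mono e2ennreal_mono simp: less_eq_ennreal.rep_eq[symmetric])

text \<open>The mean value property of harmonic functions, read off from Cauchy's formula at the centre:
  there \<open>dz / (z - c)\<close> is \<open>\<i> d\<theta>\<close>.\<close>

lemma circle_mean_Re_holomorphic:
  assumes F: "F holomorphic_on cball c r" and r: "0 < r"
  shows "circle_mean (\<lambda>z. ereal (Re (F z))) c r = ereal (Re (F c))"
proof -
  define f where "f = (\<lambda>\<theta>. F (c + of_real r * cis \<theta>))"
  have "((\<lambda>u. F u / (u - c)) has_contour_integral (2 * of_real pi * \<i> * F c)) (circlepath c r)"
    using Cauchy_integral_circlepath_simple[OF F, of c] r by simp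
  then have "((\<lambda>t. F (c + r * cis t) / ((c + r * cis t) - c) * r * \<i> * cis t)
      has_integral (2 * of_real pi * \<i> * F c)) {0..2 * pi}"
    unfolding circlepath_def by (subst (asm) has_contour_integral_part_circlepath_iff) auto
  moreover have "F (c + r * cis t) / ((c + r * cis t) - c) * r * \<i> * cis t = f t * \<i>" for t
    using r by (simp add: f_def field_simps)
  ultimately have "((\<lambda>t. f t * \<i>) has_integral (2 * of_real pi * \<i> * F c)) {0..2 * pi}"
    by (simp only:)
  then have "((\<lambda>t. f t * \<i> * (-\<i>)) has_integral (2 * of_real pi * \<i> * F c * (-\<i>))) {0..2 * pi}"
    by (rule has_integral_mult_left)
  then have "(f has_integral (2 * of_real pi * F c)) {0..2 * pi}"
    by (simp add: algebra_simps)
  from has_integral_linear[OF this bounded_linear_Re]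
  have "((\<lambda>t. Re (f t)) has_integral Re (2 * of_real pi * F c)) {0..2 * pi}"
    by (simp only: o_def)
  moreover have "Re (2 * of_real pi * F c) = 2 * pi * Re (F c)"
    by (simp add: mult.assoc)
  ultimately have 1: "((\<lambda>t. Re (f t)) has_integral (2 * pi * Re (F c))) {0..2 * pi}"
    by (simp only:)
  have cont: "continuous_on {0..2*pi} (\<lambda>t. Re (f t))"
    unfolding f_def using r
    by (intro continuous_intros continuous_on_compose2[OF holomorphic_on_imp_continuous_on[OF F]])
       (auto simp: dist_norm norm_mult)
  then have 2: "set_integrable lborel {0..2*pi} (\<lambda>t. Re (f t))"
    by (rule borel_integrable_atLeastAtMost')
  then have int: "integrable (restrict_space lborel {0..2*pi}) (\<lambda>t. Re (f t))"
    by (simp add: integrable_restrict_space set_integrable_def)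
  have "integral\<^sup>L (restrict_space lborel {0..2*pi}) (\<lambda>t. Re (f t)) = 2 * pi * Re (F c)"
    using set_borel_integral_eq_integral(2)[OF 2] integral_unique[OF 1]
    by (simp add: integral_restrict_space set_lebesgue_integral_def)
  with circle_mean_real[of "\<lambda>z. Re (F z)" c r] int show ?thesis
    by (simp add: f_def)
qed

text \<open>If \<open>h > G\<close> somewhere, then \<open>h - G + \<eta> \<bar>z\<bar>\<^sup>2\<close> with a small \<open>\<eta> > 0\<close> still has a larger
  supremum over \<open>S\<close> than over \<open>S - \<Omega>\<close>, and by upper semicontinuity it attains that supremum, at a
  point \<open>z0\<close> of \<open>\<Omega>\<close>.  The sub-mean value inequality on a circle of radius \<open>s\<close> around \<open>z0\<close> then
  fails by \<open>\<eta> s\<^sup>2\<close>.  The set \<open>S - \<Omega>\<close> plays the role of the boundary and may contain slits.\<close>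

lemma subharmonic_le_harmonic:
  assumes sh: "subharmonic_on UNIV h"
    and S: "compact S" and \<Omega>: "open \<Omega>" "\<Omega> \<subseteq> S"
    and G: "continuous_on S G"
    and harm: "\<And>z. z \<in> \<Omega> \<Longrightarrow> \<exists>F e. 0 < e \<and> F holomorphic_on ball z e \<and> (\<forall>w\<in>ball z e. G w = Re (F w))"
    and bd: "\<And>z. z \<in> S - \<Omega> \<Longrightarrow> h z \<le> ereal (G z)"
    and z: "z \<in> S"
  shows "h z \<le> ereal (G z)"
proof (rule ccontr)
  assume "\<not> ?thesis"
  then have "ereal (G z) < h z" by simp
  then obtain q where q: "ereal (G z) < ereal q" "ereal q < h z"
    using ereal_dense2 by blast
  define d where "d = q - G z"
  have d: "0 < d" "ereal (G z + d) < h z"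
    using q by (auto simp: d_def)
  obtain R where R: "\<And>w. w \<in> S \<Longrightarrow> cmod w \<le> R"
    using compact_imp_bounded[OF S] unfolding bounded_iff by blast
  define \<eta> where "\<eta> = d / (R\<^sup>2 + 1)"
  have \<eta>: "0 < \<eta>"
    using d unfolding \<eta>_def by (simp add: add_nonneg_pos)
  have \<eta>R: "\<eta> * (cmod w)\<^sup>2 < d" if "w \<in> S" for w
  proof -
    have "(cmod w)\<^sup>2 \<le> R\<^sup>2"
      using R[OF that] by (simp add: power_mono)
    then have "\<eta> * (cmod w)\<^sup>2 < \<eta> * (R\<^sup>2 + 1)"
      using \<eta> by (intro mult_strict_left_mono) auto
    also have "\<dots> = d"
      by (simp add: \<eta>_def add_nonneg_eq_0_iff)
    finally show ?thesis .
  qed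
  define P where "P = (\<lambda>w. G w - \<eta> * (cmod w)\<^sup>2)"
  have contP: "continuous_on S P"
    unfolding P_def by (intro continuous_intros G)
  have hfin: "h w < \<infinity>" for w
    using sh by (simp add: subharmonic_on_def)
  have "usc_on S h"
  proof -
    have "open {z. h z < t}" for t
      using sh unfolding subharmonic_on_def usc_on_def by simp
    then show ?thesis
      unfolding usc_on_def openin_open by (auto intro!: exI[of _ "{z. h z < _}"])
  qed
  then have "usc_on S (\<lambda>w. h w - ereal (P w))"
    using contP by (rule usc_on_minus_continuous)
  then obtain z0 where z0: "z0 \<in> S" "\<And>w. w \<in> S \<Longrightarrow> h w - ereal (P w) \<le> h z0 - ereal (P z0)"
    using usc_attains_sup[OF S] z by blast
  have "ereal d < h z - ereal (P z)"
  proof -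
    have "ereal (d + P z) \<le> ereal (G z + d)"
      using \<eta> by (simp add: P_def)
    also have "\<dots> < h z" by (rule d)
    finally show ?thesis
      by (cases "h z") auto
  qed
  also have "\<dots> \<le> h z0 - ereal (P z0)"
    by (rule z0(2)[OF z])
  finally have big: "ereal d < h z0 - ereal (P z0)" .
  then obtain x where x: "h z0 = ereal x"
    using hfin[of z0] by (cases "h z0") auto
  define m where "m = x - P z0"
  have "d < m"
    using big by (simp add: x m_def)
  have "z0 \<in> \<Omega>"
  proof (rule ccontr)
    assume "z0 \<notin> \<Omega>"
    then have "x \<le> G z0"
      using bd[of z0] z0(1) x by simp
    then show False
      using \<eta>R[OF z0(1)] \<open>d < m\<close> by (simp add: m_def P_def)
  qed
  then obtain F e where F: "0 < e" "F holomorphic_on ball z0 e" "\<And>w. w \<in> ball z0 e \<Longrightarrow> G w = Re (F w)"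
    using harm by blast
  obtain e' where e': "0 < e'" "ball z0 e' \<subseteq> \<Omega>"
    using \<Omega>(1) \<open>z0 \<in> \<Omega>\<close> open_contains_ball by blast
  define s where "s = min e e' / 2"
  have s: "0 < s" "cball z0 s \<subseteq> ball z0 e" "cball z0 s \<subseteq> \<Omega>"
    using F(1) e' by (auto simp: s_def)
  \<comment> \<open>On the circle \<open>\<bar>w - z0\<bar> = s\<close> the term \<open>\<eta> \<bar>w\<bar>\<^sup>2\<close> is the real part of a polynomial in \<open>w\<close>, so
    that the whole majorant \<open>m + P\<close> is there the real part of the holomorphic function \<open>H\<close>.\<close>
  define H where "H = (\<lambda>w. F w + of_real (m - \<eta> * ((cmod z0)\<^sup>2 + s\<^sup>2)) - of_real (2 * \<eta>) * cnj z0 * (w - z0))"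
  have holH: "H holomorphic_on cball z0 s"
    unfolding H_def by (intro holomorphic_intros holomorphic_on_subset[OF F(2)] s(2))
  have le: "h (z0 + of_real s * cis \<theta>) \<le> ereal (Re (H (z0 + of_real s * cis \<theta>)))" for \<theta>
  proof -
    define w where "w = z0 + of_real s * cis \<theta>"
    have w: "w \<in> cball z0 s"
      using s(1) by (simp add: w_def dist_norm norm_mult)
    have "w \<in> S"
      using w s(3) \<Omega>(2) by blast
    have "(cmod w)\<^sup>2 = (cmod z0)\<^sup>2 + s\<^sup>2 + 2 * Re (cnj z0 * (w - z0))"
    proof -
      have "(Re z0 + s * cos \<theta>)\<^sup>2 + (Im z0 + s * sin \<theta>)\<^sup>2 =
          (Re z0)\<^sup>2 + (Im z0)\<^sup>2 + s\<^sup>2 + 2 * (Re z0 * (s * cos \<theta>) + Im z0 * (s * sin \<theta>))"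
        using sin_cos_squared_add[of \<theta>] by algebra
      then show ?thesis
        by (simp add: w_def cmod_power2)
    qed
    then have "\<eta> * (cmod w)\<^sup>2 = \<eta> * ((cmod z0)\<^sup>2 + s\<^sup>2) + 2 * \<eta> * Re (cnj z0 * (w - z0))"
      by (simp only: ring_distribs mult_ac)
    moreover have "Re (H w) = Re (F w) + (m - \<eta> * ((cmod z0)\<^sup>2 + s\<^sup>2)) - 2 * \<eta> * Re (cnj z0 * (w - z0))"
      unfolding H_def by (simp add: algebra_simps)
    moreover have "G w = Re (F w)"
      using w s(2) F(3) by blast
    ultimately have "Re (H w) = m + P w"
      by (simp add: P_def)
    moreover have "h w - ereal (P w) \<le> ereal m"
      using z0(2)[OF \<open>w \<in> S\<close>] x by (simp add: m_def)
    then have "h w \<le> ereal (m + P w)"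
      by (cases "h w") auto
    ultimately show ?thesis
      by (simp add: w_def)
  qed
  have "ereal x \<le> circle_mean h z0 s"
    using sh s(1) unfolding subharmonic_on_def x[symmetric] by blast
  also have "\<dots> \<le> circle_mean (\<lambda>w. ereal (Re (H w))) z0 s"
    by (intro circle_mean_mono le)
  also have "\<dots> = ereal (Re (H z0))"
    by (rule circle_mean_Re_holomorphic[OF holH s(1)])
  also have "Re (H z0) = x - \<eta> * s\<^sup>2"
    using F(1) F(3)[of z0] by (simp add: H_def m_def P_def algebra_simps)
  finally show False
    using \<eta> s(1) by (simp add: mult_le_0_iff)
qed

section \<open>Three explicit comparisons in the plane\<close>

text \<open>On the upper half disc the harmonic function \<open>Re (z\<^sup>2) + 2 Im z\<close> is nonnegative on the diameter,
  at least 1 on the half circle (where it is \<open>1 - 2 q\<^sup>2 + 2 q\<close> with \<open>q = Im z \<in> {0..1}\<close>), and at most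
  \<open>2 \<beta>\<close> at \<open>\<i> \<beta>\<close>.\<close>

lemma subharmonic_le_linear_half_disc:
  assumes sh: "subharmonic_on UNIV h"
    and real: "\<And>t::real. \<bar>t\<bar> \<le> 1 \<Longrightarrow> h (of_real t) \<le> 0"
    and disc: "\<And>z. cmod z \<le> 1 \<Longrightarrow> h z \<le> ereal B"
    and B: "0 \<le> B" and \<beta>: "0 \<le> \<beta>" "\<beta> \<le> 1"
  shows "h (\<i> * of_real \<beta>) \<le> ereal (2 * \<beta> * B)"
proof -
  define G where "G = (\<lambda>z. Re (of_real B * (z\<^sup>2 - 2 * \<i> * z)))"
  define S where "S = cball 0 1 \<inter> {z. 0 \<le> Im z}"
  define \<Omega> where "\<Omega> = ball 0 1 \<inter> {z. 0 < Im z}"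
  have "h (\<i> * of_real \<beta>) \<le> ereal (G (\<i> * of_real \<beta>))"
  proof (rule subharmonic_le_harmonic[OF sh, of S \<Omega>])
    show "compact S"
      unfolding S_def by (intro compact_Int_closed closed_halfspace_Im_ge) auto
    show "open \<Omega>" "\<Omega> \<subseteq> S"
      unfolding S_def \<Omega>_def by (auto intro: open_halfspace_Im_gt)
    show "continuous_on S G"
      unfolding G_def by (intro continuous_intros)
    show "\<exists>F e. 0 < e \<and> F holomorphic_on ball z e \<and> (\<forall>w\<in>ball z e. G w = Re (F w))" for z
      unfolding G_def by (intro exI[of _ "\<lambda>z. of_real B * (z\<^sup>2 - 2 * \<i> * z)"] exI[of _ 1] conjI holomorphic_intros) auto
    show "\<i> * of_real \<beta> \<in> S"
      using \<beta> by (simp add: S_def norm_mult)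
    show "h z \<le> ereal (G z)" if "z \<in> S - \<Omega>" for z
    proof (cases "Im z = 0")
      case True
      then have z: "z = of_real (Re z)" "\<bar>Re z\<bar> \<le> 1"
        using that abs_Re_le_cmod[of z] by (auto simp: S_def complex_eq_iff)
      have "h z \<le> 0"
        using real[OF z(2)] z(1) by simp
      also have "0 \<le> ereal (G z)"
        using True B by (simp add: G_def power2_eq_square)
      finally show ?thesis .
    next
      case False
      then have z: "cmod z = 1" "0 \<le> Im z"
        using that by (auto simp: S_def \<Omega>_def)
      then have "Im z \<le> 1"
        using abs_Im_le_cmod[of z] by simp
      then have "Im z * Im z \<le> Im z * 1"
        using z(2) by (intro mult_left_mono) auto
      moreover have "(Re z)\<^sup>2 + (Im z)\<^sup>2 = 1"
        using z(1) cmod_power2[of z] by simp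
      ultimately have "1 \<le> (Re z)\<^sup>2 - (Im z)\<^sup>2 + 2 * Im z"
        by (simp add: power2_eq_square)
      then have "B * 1 \<le> B * ((Re z)\<^sup>2 - (Im z)\<^sup>2 + 2 * Im z)"
        using B by (intro mult_left_mono)
      then have "B \<le> G z"
        by (simp add: G_def power2_eq_square)
      then show ?thesis
        using disc[of z] z(1) order_trans by fastforce
    qed
  qed
  also have "G (\<i> * of_real \<beta>) = B * (2 * \<beta> - \<beta>\<^sup>2)"
    by (simp add: G_def power2_eq_square)
  also have "B * (2 * \<beta> - \<beta>\<^sup>2) \<le> 2 * \<beta> * B"
    using B by (simp add: algebra_simps)
  finally show ?thesis by simp
qed

text \<open>This is where the exponent \<open>1/2\<close> originates.  The function \<open>Re csqrt (- z)\<close> is harmonic off the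
  nonnegative axis and vanishes on it, but it is also small on the unit circle near 1.  Adding
  \<open>Re z\<close> repairs this: with \<open>q = Re csqrt (- z)\<close> and \<open>\<bar>z\<bar> = 1\<close> one has
  \<open>Re z + 2 q = 1 - 2 q\<^sup>2 + 2 q \<ge> 1\<close>.\<close>

lemma subharmonic_le_sqrt_slit_disc:
  assumes sh: "subharmonic_on UNIV h"
    and slit: "\<And>t::real. 0 \<le> t \<Longrightarrow> t \<le> 1 \<Longrightarrow> h (of_real t) \<le> ereal b"
    and disc: "\<And>z. cmod z \<le> 1 \<Longrightarrow> h z \<le> ereal B"
    and B: "0 \<le> b" "0 \<le> B" and t: "0 \<le> t" "t \<le> 1"
  shows "h (- of_real t) \<le> ereal (b + 2 * B * sqrt t)"
proof -
  \<comment> \<open>\<open>G\<close> is \<open>Re F\<close> with the square root written in real terms; in this form its continuity across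
    the branch cut is evident.\<close>
  define F where "F = (\<lambda>z. of_real b + of_real B * (z + 2 * csqrt (- z)))"
  define G where "G = (\<lambda>z. b + B * (Re z + 2 * sqrt ((cmod z - Re z) / 2)))"
  have GF: "G z = Re (F z)" for z
    by (simp add: G_def F_def)
  define \<Omega> where "\<Omega> = ball 0 1 - {z. 0 \<le> Re z \<and> Im z = 0}"
  have \<Omega>: "open \<Omega>"
    unfolding \<Omega>_def
    by (intro open_Diff open_ball closed_Collect_conj closed_Collect_le closed_Collect_eq continuous_intros)
  have hol: "F holomorphic_on \<Omega>"
    unfolding F_def by (intro holomorphic_intros) (auto simp: \<Omega>_def complex_nonpos_Reals_iff)
  have "h (- of_real t) \<le> ereal (G (- of_real t))"
  proof (rule subharmonic_le_harmonic[OF sh, of "cball 0 1" \<Omega>])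
    show "continuous_on (cball 0 1) G"
      unfolding G_def by (intro continuous_intros) auto
    show "\<exists>F e. 0 < e \<and> F holomorphic_on ball z e \<and> (\<forall>w\<in>ball z e. G w = Re (F w))"
      if "z \<in> \<Omega>" for z
      using \<Omega> that hol GF holomorphic_on_subset unfolding open_contains_ball by metis
    show "- complex_of_real t \<in> cball 0 1"
      using t by simp
    show "h z \<le> ereal (G z)" if "z \<in> cball 0 1 - \<Omega>" for z
    proof (cases "0 \<le> Re z \<and> Im z = 0")
      case True
      then have z: "z = of_real (Re z)" "Re z \<le> 1"
        using that abs_Re_le_cmod[of z] by (auto simp: complex_eq_iff)
      have "h z \<le> ereal b"
        using slit[of "Re z"] z True by simp
      also have "b \<le> G z"
        using True B abs_Re_le_cmod[of z] by (simp add: G_def)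
      finally show ?thesis by simp
    next
      case False
      then have z: "cmod z = 1"
        using that by (auto simp: \<Omega>_def)
      define q where "q = sqrt ((1 - Re z) / 2)"
      have "\<bar>Re z\<bar> \<le> 1"
        using abs_Re_le_cmod[of z] z by simp
      then have q: "0 \<le> q" "q \<le> 1" "q\<^sup>2 = (1 - Re z) / 2"
        by (auto simp: q_def)
      have "q * q \<le> q * 1"
        using q by (intro mult_left_mono) auto
      then have "1 \<le> Re z + 2 * q"
        using q(3) by (simp add: power2_eq_square)
      then have "B * 1 \<le> B * (Re z + 2 * q)"
        using B by (intro mult_left_mono)
      then have "B \<le> G z"
        using z B by (simp add: G_def q_def)
      then show ?thesis
        using disc[of z] z order_trans by fastforce
    qed
  qed (use \<Omega> in \<open>auto simp: \<Omega>_def\<close>)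
  also have "G (- of_real t) \<le> b + 2 * B * sqrt t"
    using t B by (simp add: G_def algebra_simps)
  finally show ?thesis by simp
qed

text \<open>A subharmonic function of logarithmic growth is compared with \<open>M + (1 + \<eta>) ln \<bar>z\<bar>\<close> on a large
  annulus; the surplus \<open>\<eta> ln \<bar>z\<bar>\<close> absorbs the unknown constant \<open>c\<close> on the outer circle, and
  \<open>\<eta>\<close> tends to 0 afterwards.\<close>

lemma subharmonic_le_log_outside_disc:
  assumes sh: "subharmonic_on UNIV h"
    and disc: "\<And>z. cmod z \<le> 1 \<Longrightarrow> h z \<le> ereal M"
    and growth: "\<And>z. 1 \<le> cmod z \<Longrightarrow> h z \<le> ereal (ln (cmod z) + c)"
    and z: "1 \<le> cmod z"
  shows "h z \<le> ereal (M + ln (cmod z))"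
proof (rule ereal_le_epsilon2)
  fix e :: real assume e: "0 < e"
  define \<eta> where "\<eta> = e / (ln (cmod z) + 1)"
  have lnz: "0 \<le> ln (cmod z)"
    using z by simp
  then have \<eta>: "0 < \<eta>"
    using e by (simp add: \<eta>_def)
  have "\<eta> * ln (cmod z) \<le> \<eta> * (ln (cmod z) + 1)"
    using \<eta> by simp
  also have "\<dots> = e"
    using lnz by (simp add: \<eta>_def)
  finally have \<eta>z: "\<eta> * ln (cmod z) \<le> e" .
  define R where "R = max (cmod z) (exp (max 0 ((c - M) / \<eta>)))"
  have R1: "1 \<le> R" "cmod z \<le> R"
    using z by (auto simp: R_def)
  have "(c - M) / \<eta> \<le> ln (exp (max 0 ((c - M) / \<eta>)))"
    by simp
  also have "\<dots> \<le> ln R"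
    unfolding R_def by (intro ln_mono) auto
  finally have R2: "c - M \<le> \<eta> * ln R"
    using \<eta> by (simp add: field_simps)
  define G where "G = (\<lambda>w. M + (1 + \<eta>) * ln (cmod w))"
  have "h z \<le> ereal (G z)"
  proof (rule subharmonic_le_harmonic[OF sh, of "cball 0 R - ball 0 1" "ball 0 R - cball 0 1"])
    show "compact (cball (0::complex) R - ball 0 1)"
      by (intro compact_diff) auto
    show "continuous_on (cball 0 R - ball 0 1) G"
      unfolding G_def by (intro continuous_intros) auto
    \<comment> \<open>Near \<open>w\<close> the function \<open>ln \<bar>x\<bar>\<close> is the real part of a branch of the logarithm; dividing by
      \<open>w\<close> moves the ball into the right half plane, where \<open>Ln\<close> is holomorphic.\<close>
    show "\<exists>F e. 0 < e \<and> F holomorphic_on ball w e \<and> (\<forall>w\<in>ball w e. G w = Re (F w))"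
      if "w \<in> ball 0 R - cball 0 1" for w
    proof -
      have w: "w \<noteq> 0"
        using that by auto
      have pos: "0 < Re (x / w)" if "x \<in> ball w (cmod w)" for x
      proof -
        have "cmod (1 - x / w) = cmod (w - x) / cmod w"
          using w by (simp add: norm_divide[symmetric] diff_divide_distrib)
        also have "\<dots> < 1"
          using that w by (simp add: dist_norm)
        finally show ?thesis
          using abs_Re_le_cmod[of "1 - x / w"] by simp
      qed
      define F where "F = (\<lambda>x. of_real M + of_real (1 + \<eta>) * (of_real (ln (cmod w)) + Ln (x / w)))"
      have "F holomorphic_on ball w (cmod w)"
        unfolding F_def using pos w
        by (intro holomorphic_intros) (auto simp: complex_nonpos_Reals_iff, force)
      moreover have "G x = Re (F x)" if "x \<in> ball w (cmod w)" for x
      proof -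
        have x: "x \<noteq> 0" using pos[OF that] by auto
        then have "Re (Ln (x / w)) = ln (cmod x) - ln (cmod w)"
          using w by (simp add: norm_divide ln_div)
        then show ?thesis
          by (simp add: F_def G_def)
      qed
      ultimately show ?thesis
        using w by (intro exI[of _ F] exI[of _ "cmod w"]) auto
    qed
    show "h w \<le> ereal (G w)"
      if "w \<in> cball 0 R - ball 0 1 - (ball 0 R - cball 0 1)" for w
    proof (cases "cmod w \<le> 1")
      case True
      then have "cmod w = 1" using that by auto
      then show ?thesis
        using disc[of w] by (simp add: G_def)
    next
      case False
      then have w: "cmod w = R" using that by auto
      then have "h w \<le> ereal (ln R + c)"
        using growth[of w] R1 by simp
      also have "ln R + c \<le> G w"
        using R2 w by (simp add: G_def algebra_simps)
      finally show ?thesis by simp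
    qed
    show "z \<in> cball 0 R - ball 0 1"
      using z R1 by auto
  qed auto
  also have "G z \<le> M + ln (cmod z) + e"
    using \<eta>z by (simp add: G_def algebra_simps)
  finally show "h z \<le> ereal (M + ln (cmod z)) + ereal e" by simp
qed

section \<open>Functions of the Lelong class on complex lines\<close>

lemma of_real_vector_scalar_mult: "of_real t *s v = t *\<^sub>R v" for v :: "complex ^ 'n"
  unfolding vec_eq_iff by (simp, simp add: scaleR_conv_of_real)

lemma norm_vector_scalar_mult: "norm (l *s v) = cmod l * norm v" for v :: "complex ^ 'n"
  by (simp add: norm_vec_def norm_mult L2_set_right_distrib)

text \<open>Used for \<open>V = range complexify\<close> and for \<open>V = UNIV\<close>: balls of \<open>V\<close> are the real balls in the
  first case and the complex ones in the second, so one argument covers both kinds of convex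
  bodies.\<close>

definition real_spanning :: "(complex ^ 'n) set \<Rightarrow> bool" where
  "real_spanning V \<longleftrightarrow> subspace V \<and>
     (\<forall>w. \<exists>x\<in>V. \<exists>y\<in>V. w = x + \<i> *s y \<and> norm x \<le> norm w \<and> norm y \<le> norm w)"

lemma Lelong_class_subharmonic:
  "u \<in> Lelong_class \<Longrightarrow> subharmonic_on UNIV (\<lambda>l. u (a + l *s b))"
  by (simp add: Lelong_class_def plurisubharmonic_on_def)

lemma Lelong_class_growth:
  assumes "u \<in> Lelong_class"
  obtains c where "0 \<le> c" "\<And>z. u z \<le> ereal (ln (1 + norm z) + c)"
proof -
  obtain c where c: "\<And>z. u z \<le> ereal (max 0 (ln (norm z)) + c)"
    using assms by (auto simp: Lelong_class_def)
  have "u z \<le> ereal (ln (1 + norm z) + max 0 c)" for z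
  proof -
    have "ln (norm z) \<le> ln (1 + norm z)"
      by (cases "z = 0") (auto intro: ln_mono)
    moreover have "0 \<le> ln (1 + norm z)"
      by simp
    ultimately have "max 0 (ln (norm z)) + c \<le> ln (1 + norm z) + max 0 c"
      by linarith
    then show ?thesis
      using c order_trans ereal_less_eq(3) by blast
  qed
  then show ?thesis
    using that[of "max 0 c"] by simp
qed

lemma Lelong_class_le_log:
  fixes u :: "complex ^ 'n \<Rightarrow> ereal"
  assumes u: "u \<in> Lelong_class" and s: "0 < s"
    and ball: "\<And>z. norm (z - c) \<le> s \<Longrightarrow> u z \<le> ereal M"
    and w: "s \<le> norm (w - c)"
  shows "u w \<le> ereal (M + ln (norm (w - c) / s))"
proof -
  obtain k where k: "0 \<le> k" "\<And>z. u z \<le> ereal (ln (1 + norm z) + k)"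
    using Lelong_class_growth[OF u] by blast
  define r where "r = norm (w - c) / s"
  have r: "1 \<le> r"
    using w s by (simp add: r_def)
  define e where "e = (1 / r) *\<^sub>R (w - c)"
  have e: "norm e = s"
    using r s w by (auto simp: e_def r_def)
  define h where "h = (\<lambda>l. u (c + l *s e))"
  have "h (of_real r) \<le> ereal (M + ln (cmod (of_real r)))"
  proof (rule subharmonic_le_log_outside_disc)
    show "subharmonic_on UNIV h"
      unfolding h_def by (rule Lelong_class_subharmonic[OF u])
    show "h l \<le> ereal M" if "cmod l \<le> 1" for l
    proof -
      have "cmod l * s \<le> s"
        using that s mult_right_mono[of "cmod l" 1 s] by simp
      then show ?thesis
        unfolding h_def by (intro ball) (simp add: norm_vector_scalar_mult e)
    qed
    show "h l \<le> ereal (ln (cmod l) + (ln (1 + norm c + s) + k))" if "1 \<le> cmod l" for l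
    proof -
      have "norm (c + l *s e) \<le> norm c + cmod l * s"
        using norm_triangle_ineq[of c "l *s e"] by (simp add: norm_vector_scalar_mult e)
      moreover have "norm c \<le> cmod l * norm c"
        using that mult_right_mono[of 1 "cmod l" "norm c"] by simp
      ultimately have "1 + norm (c + l *s e) \<le> cmod l * (1 + norm c + s)"
        using that by (simp add: algebra_simps)
      then have "ln (1 + norm (c + l *s e)) \<le> ln (cmod l * (1 + norm c + s))"
        by (intro ln_mono) (auto intro: add_pos_nonneg)
      also have "\<dots> = ln (cmod l) + ln (1 + norm c + s)"
        using that s by (intro ln_mult_pos) (auto intro!: add_pos_nonneg)
      finally have "ln (1 + norm (c + l *s e)) + k \<le> ln (cmod l) + (ln (1 + norm c + s) + k)"
        by simp
      then show ?thesis
        unfolding h_def using k(2) order_trans ereal_less_eq(3) by blast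
    qed
  qed (use r in auto)
  moreover have "c + of_real r *s e = w"
    using r by (simp add: of_real_vector_scalar_mult e_def)
  ultimately show ?thesis
    using r s by (simp add: h_def r_def norm_divide)
qed

text \<open>A bound that is uniform over all competitors \<open>u\<close>, whose growth constants are not.  Let \<open>M\<close> bound
  \<open>u\<close> on the ball of radius \<open>\<rho>\<close>.  A point \<open>c + x + \<i> y\<close> of the ball of radius \<open>\<rho> / 5\<close> lies on the
  complexification of a real segment in the zero ball, and the half disc comparison halves the
  bound there; logarithmic growth returns to radius \<open>\<rho>\<close> at the cost of \<open>ln 5\<close>.  Thus \<open>M\<close> improves
  to \<open>M / 2 + ln 5\<close>, and iterating leaves only the fixed point \<open>2 ln 5\<close>.\<close>

lemma Lelong_class_le_log_real_ball:
  fixes u :: "complex ^ 'n \<Rightarrow> ereal"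
  assumes u: "u \<in> Lelong_class" and V: "real_spanning V" and \<rho>: "0 < \<rho>"
    and ball: "\<And>p. p \<in> V \<Longrightarrow> norm p \<le> \<rho> \<Longrightarrow> u (c + p) \<le> 0"
  shows "u w \<le> ereal (2 * ln 5 + ln (1 + norm (w - c) / \<rho>))"
proof -
  have subV: "subspace V"
    using V by (simp add: real_spanning_def)
  have contract: "u z \<le> ereal (M / 2 + ln 5)"
    if M: "0 \<le> M" "\<And>z. norm (z - c) \<le> \<rho> \<Longrightarrow> u z \<le> ereal M" and z: "norm (z - c) \<le> \<rho>" for M z
  proof -
    have small: "u z \<le> ereal (M / 2)" if z: "norm (z - c) \<le> \<rho> / 5" for z
    proof -
      obtain x y where xy: "x \<in> V" "y \<in> V" "z - c = x + \<i> *s y"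
        "norm x \<le> norm (z - c)" "norm y \<le> norm (z - c)"
        using V unfolding real_spanning_def by blast
      have n: "norm (x + l *s (4 *\<^sub>R y)) \<le> \<rho>" if "cmod l \<le> 1" for l
      proof -
        have "cmod l * (4 * norm y) \<le> 4 * norm y"
          using that mult_right_mono[of "cmod l" 1 "4 * norm y"] by simp
        then show ?thesis
          using norm_triangle_ineq[of x "l *s (4 *\<^sub>R y)"] xy z
          by (simp add: norm_vector_scalar_mult)
      qed
      define h where "h = (\<lambda>l. u ((c + x) + l *s (4 *\<^sub>R y)))"
      have "h (\<i> * of_real (1/4)) \<le> ereal (2 * (1/4) * M)"
      proof (rule subharmonic_le_linear_half_disc)
        show "subharmonic_on UNIV h"
          unfolding h_def by (rule Lelong_class_subharmonic[OF u])
        show "h (of_real t) \<le> 0" if "\<bar>t\<bar> \<le> 1" for t :: real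
        proof -
          have "x + of_real t *s (4 *\<^sub>R y) \<in> V"
            unfolding of_real_vector_scalar_mult using xy subV
            by (intro subspace_add subspace_scale) auto
          from ball[OF this] show ?thesis
            using n[of "of_real t"] that by (simp add: h_def add.assoc)
        qed
        show "h l \<le> ereal M" if "cmod l \<le> 1" for l
          unfolding h_def by (rule M(2)) (use n[OF that] in \<open>simp add: algebra_simps\<close>)
      qed (use M in auto)
      moreover have "(c + x) + (\<i> * of_real (1/4)) *s (4 *\<^sub>R y) = z"
      proof -
        have "z = c + (x + \<i> *s y)"
          using xy(3) by (simp add: algebra_simps)
        then show ?thesis
          by (simp add: vec_eq_iff scaleR_conv_of_real)
      qed
      ultimately show ?thesis
        by (simp add: h_def)
    qed
    show ?thesis
    proof (cases "norm (z - c) \<le> \<rho> / 5")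
      case True
      then have "u z \<le> ereal (M / 2)" by (rule small)
      also have "M / 2 \<le> M / 2 + ln 5" by simp
      finally show ?thesis by simp
    next
      case False
      then have "u z \<le> ereal (M / 2 + ln (norm (z - c) / (\<rho> / 5)))"
        using \<rho> by (intro Lelong_class_le_log[OF u _ small]) auto
      also have "ln (norm (z - c) / (\<rho> / 5)) \<le> ln 5"
        using z \<rho> False by (intro ln_mono) (auto simp: field_simps)
      finally show ?thesis by simp
    qed
  qed
  obtain k where k: "0 \<le> k" "\<And>z. u z \<le> ereal (ln (1 + norm z) + k)"
    using Lelong_class_growth[OF u] by blast
  define M where "M = ln (1 + (norm c + \<rho>)) + k"
  have M: "0 \<le> M"
    unfolding M_def using \<rho> k by (intro add_nonneg_nonneg ln_ge_zero) auto
  have iter: "u z \<le> ereal (M / 2 ^ n + 2 * ln 5)" if "norm (z - c) \<le> \<rho>" for z n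
    using that
  proof (induction n arbitrary: z)
    case 0
    have "norm z \<le> norm c + \<rho>"
      using norm_triangle_ineq[of c "z - c"] 0 by simp
    then have "ln (1 + norm z) + k \<le> M"
      unfolding M_def by (intro add_right_mono ln_mono) (auto intro: add_pos_nonneg)
    moreover have "0 \<le> ln (5::real)" by simp
    ultimately have "ln (1 + norm z) + k \<le> M + 2 * ln 5" by linarith
    then show ?case
      using k(2)[of z] order_trans ereal_less_eq(3) by (metis div_by_1 power_0)
  next
    case (Suc n)
    have "u z \<le> ereal ((M / 2 ^ n + 2 * ln 5) / 2 + ln 5)"
      using M by (intro contract Suc) auto
    then show ?case
      by (simp add: add_divide_distrib algebra_simps)
  qed
  have unit: "u z \<le> ereal (2 * ln 5)" if "norm (z - c) \<le> \<rho>" for z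
  proof (rule LIMSEQ_le_const)
    have "(\<lambda>n. M * (1/2) ^ n + 2 * ln 5) \<longlonglongrightarrow> M * 0 + 2 * ln 5"
      by (intro tendsto_intros LIMSEQ_power_zero) auto
    then show "(\<lambda>n. ereal (M / 2 ^ n + 2 * ln 5)) \<longlonglongrightarrow> ereal (2 * ln 5)"
      by (simp add: power_divide)
    show "\<exists>N. \<forall>n\<ge>N. u z \<le> ereal (M / 2 ^ n + 2 * ln 5)"
      using iter[OF that] by blast
  qed
  show ?thesis
  proof (cases "norm (w - c) \<le> \<rho>")
    case True
    have "2 * ln 5 \<le> 2 * ln 5 + ln (1 + norm (w - c) / \<rho>)"
      using \<rho> by simp
    then show ?thesis
      using unit[OF True] order_trans ereal_less_eq(3) by blast
  next
    case False
    then have "u w \<le> ereal (2 * ln 5 + ln (norm (w - c) / \<rho>))"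
      using \<rho> by (intro Lelong_class_le_log[OF u _ unit]) auto
    also have "ln (norm (w - c) / \<rho>) \<le> ln (1 + norm (w - c) / \<rho>)"
      using False \<rho> by (intro ln_mono) (auto intro!: divide_pos_pos)
    finally show ?thesis by simp
  qed
qed

section \<open>Square root decay at the vertex of a cone\<close>

text \<open>The square root bound is known down to scale \<open>\<eta>\<close> and is carried over to scale \<open>\<eta> / 2\<close> with the
  same constant \<open>A\<close>.  Write \<open>w = x + \<i> y\<close> and \<open>\<epsilon> = max \<bar>w\<bar> (\<eta> / 2)\<close>.  For \<open>t \<ge> T = K \<epsilon>\<close> the cone
  contains a translate of a ball of \<open>V\<close> with centre \<open>x + t v\<close> and radius proportional to \<open>t\<close>, so the
  half disc comparison in the direction \<open>y\<close>, with the bound \<open>A sqrt (t (D + \<rho>))\<close> that is already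
  known at scale \<open>t\<close>, gives \<open>u (w + t v) = O(\<epsilon> / t * A sqrt t)\<close>.  Since \<open>t \<ge> K \<epsilon>\<close>, this is
  \<open>O(A sqrt \<epsilon> / sqrt K)\<close>, hence at most half of what is allowed if \<open>K\<close> is large.  On the complex line
  through \<open>w\<close> in the direction \<open>v\<close> these points form a slit whose tip differs from \<open>w\<close> by
  \<open>T\<close> in the parameter \<open>t\<close>, and the slit disc comparison costs only \<open>O(B sqrt T) = O(B sqrt (K \<epsilon>))\<close>; that is the other half
  as soon as \<open>A\<close> is large compared with \<open>B sqrt K\<close>.\<close>

lemma Lelong_class_sqrt_halving:
  fixes u :: "complex ^ 'n \<Rightarrow> ereal"
  assumes u: "u \<in> Lelong_class" and V: "real_spanning V"
    and v: "norm v \<le> D" "1 \<le> D" and \<rho>: "0 < \<rho>"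
    and cone: "\<And>\<tau> p. 0 \<le> \<tau> \<Longrightarrow> \<tau> \<le> 1 \<Longrightarrow> p \<in> V \<Longrightarrow> norm p \<le> \<rho> \<Longrightarrow> u (\<tau> *\<^sub>R (v + p)) \<le> 0"
    and B: "0 \<le> B" "\<And>w. norm w \<le> 1 + D \<Longrightarrow> u w \<le> ereal B"
    and K: "2 \<le> K" "2 \<le> K * \<rho>" "64 * (D + \<rho>) \<le> K * \<rho>\<^sup>2"
    and A: "4 * B * sqrt (2 * K) \<le> A"
    and \<eta>: "0 < \<eta>" "K * \<eta> \<le> 1 / 2"
    and bd: "\<And>w. u w \<le> ereal (A * sqrt (max (norm w) \<eta>))"
  shows "u w \<le> ereal (A * sqrt (max (norm w) (\<eta> / 2)))"
proof (cases "\<eta> \<le> norm w")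
  case True
  then show ?thesis
    using bd[of w] \<eta> by (simp add: max_def split: if_splits)
next
  case False
  define \<epsilon> where "\<epsilon> = max (norm w) (\<eta> / 2)"
  have \<epsilon>: "0 < \<epsilon>" "\<eta> \<le> 2 * \<epsilon>" "\<epsilon> < \<eta>" "norm w \<le> \<epsilon>"
    using \<eta> False by (auto simp: \<epsilon>_def)
  define T where "T = K * \<epsilon>"
  have "2 * \<epsilon> \<le> T"
    unfolding T_def using K \<epsilon> by (intro mult_right_mono) auto
  moreover have "T \<le> K * \<eta>"
    unfolding T_def using K \<epsilon> by (intro mult_left_mono) auto
  ultimately have T: "\<eta> \<le> T" "2 * \<epsilon> \<le> T" "T \<le> 1 / 2" "0 < T"
    using \<epsilon> \<eta> by auto
  have A0: "0 \<le> A"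
    using A B K by (intro order_trans[OF _ A]) auto
  obtain x y where xy: "x \<in> V" "y \<in> V" "w = x + \<i> *s y" "norm x \<le> \<epsilon>" "norm y \<le> \<epsilon>"
    using V \<epsilon>(4) order_trans unfolding real_spanning_def by blast
  have subV: "subspace V"
    using V by (simp add: real_spanning_def)
  have near: "u (w + t *\<^sub>R v) \<le> ereal (A / 2 * sqrt \<epsilon>)" if t: "T \<le> t" "t \<le> 1" for t
  proof -
    have t0: "0 < t" using t T by simp
    have "2 * \<epsilon> \<le> K * \<rho> * \<epsilon>"
      using K \<epsilon> by (intro mult_right_mono) auto
    also have "\<dots> = T * \<rho>"
      by (simp add: T_def)
    also have "\<dots> \<le> t * \<rho>"
      using t \<rho> by (intro mult_right_mono) auto
    finally have \<epsilon>t: "2 * \<epsilon> \<le> t * \<rho>" .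
    \<comment> \<open>Chosen so that \<open>y / \<beta>\<close> has norm at most \<open>t \<rho> / 2\<close>: the real unit segment in that direction
      stays in the cone, and \<open>w + t v\<close> is reached at the parameter \<open>\<i> \<beta>\<close>.\<close>
    define \<beta> where "\<beta> = 2 * \<epsilon> / (t * \<rho>)"
    have \<beta>: "0 < \<beta>" "\<beta> \<le> 1"
      using \<epsilon> t0 \<rho> \<epsilon>t by (auto simp: \<beta>_def)
    define b where "b = (1 / \<beta>) *\<^sub>R y"
    have "norm y / \<beta> \<le> \<epsilon> / \<beta>"
      using xy \<beta> by (intro divide_right_mono) auto
    then have b: "norm b \<le> t * \<rho> / 2"
      using \<beta> \<epsilon> by (simp add: b_def) (simp add: \<beta>_def)
    have n: "norm (x + l *s b) \<le> t * \<rho>" if "cmod l \<le> 1" for l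
    proof -
      have "cmod l * norm b \<le> t * \<rho> / 2"
        using that b mult_mono[of "cmod l" 1 "norm b" "t * \<rho> / 2"] by simp
      then show ?thesis
        using norm_triangle_ineq[of x "l *s b"] xy \<epsilon>t by (simp add: norm_vector_scalar_mult)
    qed
    define h where "h = (\<lambda>l. u ((x + t *\<^sub>R v) + l *s b))"
    have "h (\<i> * of_real \<beta>) \<le> ereal (2 * \<beta> * (A * sqrt (t * (D + \<rho>))))"
    proof (rule subharmonic_le_linear_half_disc)
      show "subharmonic_on UNIV h"
        unfolding h_def by (rule Lelong_class_subharmonic[OF u])
      show "h (of_real s) \<le> 0" if "\<bar>s\<bar> \<le> 1" for s :: real
      proof -
        define p where "p = (1 / t) *\<^sub>R (x + s *\<^sub>R b)"
        have "p \<in> V"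
          unfolding p_def b_def using xy subV
          by (intro subspace_add subspace_scale) auto
        moreover have "norm p \<le> \<rho>"
          using n[of "of_real s"] that t0
          unfolding p_def norm_scaleR of_real_vector_scalar_mult by (simp add: pos_divide_le_eq mult.commute)
        ultimately have "u (t *\<^sub>R (v + p)) \<le> 0"
          using t t0 by (intro cone) auto
        moreover have "t *\<^sub>R (v + p) = (x + t *\<^sub>R v) + of_real s *s b"
          using t0 by (simp add: p_def of_real_vector_scalar_mult algebra_simps)
        ultimately show ?thesis
          by (simp add: h_def)
      qed
      show "h l \<le> ereal (A * sqrt (t * (D + \<rho>)))" if "cmod l \<le> 1" for l
      proof -
        have "norm ((x + t *\<^sub>R v) + l *s b) \<le> norm (x + l *s b) + norm (t *\<^sub>R v)"
          using norm_triangle_ineq[of "x + l *s b" "t *\<^sub>R v"] by (simp add: algebra_simps)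
        also have "\<dots> \<le> t * \<rho> + t * D"
          using n[OF that] v t0 by (intro add_mono) auto
        finally have 1: "norm ((x + t *\<^sub>R v) + l *s b) \<le> t * (D + \<rho>)"
          by (simp add: algebra_simps)
        have "t * 1 \<le> t * (D + \<rho>)"
          using t0 v \<rho> by (intro mult_left_mono) auto
        then have "\<eta> \<le> t * (D + \<rho>)"
          using T t by linarith
        with 1 have "A * sqrt (max (norm ((x + t *\<^sub>R v) + l *s b)) \<eta>) \<le> A * sqrt (t * (D + \<rho>))"
          using A0 by (intro mult_left_mono real_sqrt_le_mono) auto
        then show ?thesis
          unfolding h_def using bd order_trans ereal_less_eq(3) by blast
      qed
    qed (use \<beta> A0 t0 v \<rho> in auto)
    moreover have "(x + t *\<^sub>R v) + (\<i> * of_real \<beta>) *s b = w + t *\<^sub>R v"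
    proof -
      have "(\<i> * of_real \<beta>) *s b = \<i> *s (of_real \<beta> *s b)"
        by simp
      also have "of_real \<beta> *s b = y"
        using \<beta> by (simp add: of_real_vector_scalar_mult b_def)
      finally show ?thesis
        by (simp add: xy(3))
    qed
    moreover have "2 * \<beta> * (A * sqrt (t * (D + \<rho>))) \<le> A / 2 * sqrt \<epsilon>"
    proof -
      have "64 * (D + \<rho>) * \<epsilon> \<le> K * \<rho>\<^sup>2 * \<epsilon>"
        using K \<epsilon> by (intro mult_right_mono) auto
      also have "\<dots> = \<rho>\<^sup>2 * T"
        by (simp add: T_def)
      also have "\<dots> \<le> \<rho>\<^sup>2 * t"
        using t by (intro mult_left_mono) auto
      finally have "64 * (D + \<rho>) * \<epsilon> * (\<epsilon> * t) \<le> \<rho>\<^sup>2 * t * (\<epsilon> * t)"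
        using \<epsilon> t0 by (intro mult_right_mono) auto
      then have "(8 * \<epsilon>)\<^sup>2 * (t * (D + \<rho>)) \<le> (t * \<rho>)\<^sup>2 * \<epsilon>"
        by (simp add: power2_eq_square algebra_simps)
      then have "sqrt ((8 * \<epsilon>)\<^sup>2 * (t * (D + \<rho>))) \<le> sqrt ((t * \<rho>)\<^sup>2 * \<epsilon>)"
        by (rule real_sqrt_le_mono)
      then have "8 * \<epsilon> * sqrt (t * (D + \<rho>)) \<le> t * \<rho> * sqrt \<epsilon>"
        using \<epsilon> t0 \<rho> by (simp add: real_sqrt_mult)
      then have "4 * \<beta> * sqrt (t * (D + \<rho>)) \<le> sqrt \<epsilon>"
        using t0 \<rho> by (simp add: \<beta>_def field_simps)
      then have "A / 2 * (4 * \<beta> * sqrt (t * (D + \<rho>))) \<le> A / 2 * sqrt \<epsilon>"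
        using A0 by (intro mult_left_mono) auto
      then show ?thesis
        by (simp add: mult_ac)
    qed
    ultimately show ?thesis
      unfolding h_def using order_trans ereal_less_eq(3) by metis
  qed
  \<comment> \<open>The factor \<open>1/2\<close> keeps \<open>T + s / 2 \<le> 1\<close> for \<open>s \<le> 1\<close>; the point \<open>w\<close> then sits at the parameter
    \<open>- 2 T\<close>.\<close>
  define h where "h = (\<lambda>l. u ((w + T *\<^sub>R v) + l *s ((1/2) *\<^sub>R v)))"
  have real: "(w + T *\<^sub>R v) + of_real s *s ((1/2) *\<^sub>R v) = w + (T + s / 2) *\<^sub>R v" for s
    by (simp add: of_real_vector_scalar_mult algebra_simps)
  have "h (- of_real (2 * T)) \<le> ereal (A / 2 * sqrt \<epsilon> + 2 * B * sqrt (2 * T))"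
  proof (rule subharmonic_le_sqrt_slit_disc)
    show "subharmonic_on UNIV h"
      unfolding h_def by (rule Lelong_class_subharmonic[OF u])
    show "h (of_real s) \<le> ereal (A / 2 * sqrt \<epsilon>)" if "0 \<le> s" "s \<le> 1" for s :: real
      unfolding h_def real using that T by (intro near) auto
    show "h l \<le> ereal B" if "cmod l \<le> 1" for l
    proof -
      have "norm ((w + T *\<^sub>R v) + l *s ((1/2) *\<^sub>R v)) \<le> norm w + norm (T *\<^sub>R v) + norm (l *s ((1/2) *\<^sub>R v))"
        using norm_triangle_ineq[of "w + T *\<^sub>R v" "l *s ((1/2) *\<^sub>R v)"] norm_triangle_ineq[of w "T *\<^sub>R v"]
        by linarith
      moreover have "norm (T *\<^sub>R v) \<le> 1 / 2 * D"
        using T v mult_mono[of T "1/2" "norm v" D] by simp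
      moreover have "norm (l *s ((1/2) *\<^sub>R v)) \<le> 1 / 2 * D"
        using that v mult_mono[of "cmod l" 1 "norm v" D] by (simp add: norm_vector_scalar_mult)
      ultimately show ?thesis
        unfolding h_def using \<epsilon> T by (intro B) auto
    qed
  qed (use A0 B T \<epsilon> in auto)
  moreover have "(w + T *\<^sub>R v) + (- of_real (2 * T)) *s ((1/2) *\<^sub>R v) = w"
    using real[of "- (2 * T)"] by simp
  moreover have "A / 2 * sqrt \<epsilon> + 2 * B * sqrt (2 * T) \<le> A * sqrt \<epsilon>"
  proof -
    have "4 * B * sqrt (2 * K) * sqrt \<epsilon> \<le> A * sqrt \<epsilon>"
      using A \<epsilon> by (intro mult_right_mono) auto
    then show ?thesis
      by (simp add: T_def real_sqrt_mult mult_ac)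
  qed
  ultimately show ?thesis
    unfolding h_def \<epsilon>_def[symmetric] using order_trans ereal_less_eq(3) by metis
qed

text \<open>Halving the scale repeatedly, starting from the uniform logarithmic bound at a fixed scale
  \<open>\<eta>\<close>, gives the square root bound at every scale.  The constant depends only on \<open>D\<close> and \<open>\<rho>\<close>,
  not on the competitor, and the bound holds for all \<open>w\<close>, however large; both matter when cones of
  different sizes are rescaled to this one.\<close>

lemma Lelong_class_le_sqrt_cone:
  assumes "1 \<le> D" and \<rho>: "0 < \<rho>"
  shows "\<exists>A>0. \<forall>(u :: complex ^ 'n \<Rightarrow> ereal) V v w.
    u \<in> Lelong_class \<longrightarrow> real_spanning V \<longrightarrow> norm v \<le> D \<longrightarrow>
    (\<forall>\<tau> p. 0 \<le> \<tau> \<longrightarrow> \<tau> \<le> 1 \<longrightarrow> p \<in> V \<longrightarrow> norm p \<le> \<rho> \<longrightarrow> u (\<tau> *\<^sub>R (v + p)) \<le> 0) \<longrightarrow>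
    u w \<le> ereal (A * sqrt (norm w))"
proof -
  \<comment> \<open>\<open>L t\<close> is the uniform bound on the ball of radius \<open>t\<close> around the vertex, \<open>A2\<close> a constant for
    which \<open>A2 sqrt m\<close> dominates \<open>L m\<close> at all scales \<open>m \<ge> \<eta>\<close>.\<close>
  define L where "L = (\<lambda>t::real. 2 * ln 5 + ln (1 + (t + D) / \<rho>))"
  define B where "B = L (1 + D)"
  define K where "K = max 2 (max (2 / \<rho>) (64 * (D + \<rho>) / \<rho>\<^sup>2))"
  have K: "2 \<le> K" "2 \<le> K * \<rho>" "64 * (D + \<rho>) \<le> K * \<rho>\<^sup>2"
  proof -
    show "2 \<le> K" by (simp add: K_def)
    have "2 / \<rho> \<le> K" "64 * (D + \<rho>) / \<rho>\<^sup>2 \<le> K"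
      unfolding K_def by auto
    then show "2 \<le> K * \<rho>" "64 * (D + \<rho>) \<le> K * \<rho>\<^sup>2"
      using \<rho> by (simp_all add: pos_divide_le_eq)
  qed
  define \<eta> where "\<eta> = 1 / (2 * K)"
  have \<eta>: "0 < \<eta>" "K * \<eta> \<le> 1 / 2"
    using K by (auto simp: \<eta>_def)
  have L0: "0 \<le> L t" if "0 \<le> t" for t
    unfolding L_def using that assms by (intro add_nonneg_nonneg ln_ge_zero) auto
  define A2 where "A2 = 2 * ln 5 / sqrt \<eta> + 2 * sqrt ((1 + D / \<rho>) / \<eta> + 1 / \<rho>)"
  define A where "A = max A2 (4 * B * sqrt (2 * K))"
  have A2: "L m \<le> A2 * sqrt m" if m: "\<eta> \<le> m" for m
  proof -
    have m0: "0 < m" using \<eta> m by simp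
    define X where "X = 1 + (m + D) / \<rho>"
    have X: "1 \<le> X"
      using m0 assms by (simp add: X_def)
    have "ln X = 2 * ln (sqrt X)"
      using X by (simp add: ln_sqrt)
    also have "ln (sqrt X) \<le> sqrt X"
      using X by (intro ln_bound) auto
    finally have 1: "ln X \<le> 2 * sqrt X" by simp
    have "(1 + D / \<rho>) * \<eta> \<le> (1 + D / \<rho>) * m"
      using m assms by (intro mult_left_mono) auto
    then have "1 + D / \<rho> \<le> (1 + D / \<rho>) / \<eta> * m"
      using \<eta> by (simp add: pos_le_divide_eq)
    then have "X \<le> ((1 + D / \<rho>) / \<eta> + 1 / \<rho>) * m"
      by (simp add: X_def algebra_simps add_divide_distrib)
    then have "sqrt X \<le> sqrt ((1 + D / \<rho>) / \<eta> + 1 / \<rho>) * sqrt m"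
      unfolding real_sqrt_mult[symmetric] by (rule real_sqrt_le_mono)
    moreover have "2 * ln 5 \<le> 2 * ln 5 / sqrt \<eta> * sqrt m"
      using m \<eta> by (simp add: field_simps)
    ultimately show ?thesis
      using 1 by (simp add: L_def X_def A2_def algebra_simps)
  qed
  have B0: "0 \<le> B"
    unfolding B_def using assms by (intro L0) auto
  have "0 < 2 * ln (5::real) / sqrt \<eta>" "0 \<le> sqrt ((1 + D / \<rho>) / \<eta> + 1 / \<rho>)"
    using \<eta> assms by auto
  then have A0: "0 < A"
    unfolding A_def A2_def by linarith
  have A1: "4 * B * sqrt (2 * K) \<le> A" "A2 \<le> A"
    by (auto simp: A_def)
  have "u w \<le> ereal (A * sqrt (norm w))"
    if u: "u \<in> Lelong_class" and V: "real_spanning V" and v: "norm v \<le> D"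
      and cone: "\<And>\<tau> p. 0 \<le> \<tau> \<Longrightarrow> \<tau> \<le> 1 \<Longrightarrow> p \<in> V \<Longrightarrow> norm p \<le> \<rho> \<Longrightarrow> u (\<tau> *\<^sub>R (v + p)) \<le> 0"
    for u :: "complex ^ 'n \<Rightarrow> ereal" and V v w
  proof -
    have coarse: "u z \<le> ereal (L t)" if "norm z \<le> t" for z t
    proof -
      have "u z \<le> ereal (2 * ln 5 + ln (1 + norm (z - v) / \<rho>))"
        using cone[of 1] by (intro Lelong_class_le_log_real_ball[OF u V \<rho>]) auto
      moreover have "norm (z - v) \<le> t + D"
        using norm_triangle_ineq4[of z v] that v by simp
      then have "ln (1 + norm (z - v) / \<rho>) \<le> ln (1 + (t + D) / \<rho>)"
        using \<rho> by (intro ln_mono add_left_mono divide_right_mono) (auto intro: add_pos_nonneg)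
      ultimately show ?thesis
        unfolding L_def by (meson add_left_mono ereal_less_eq(3) order_trans)
    qed
    have scale: "u z \<le> ereal (A * sqrt (max (norm z) (\<eta> / 2 ^ n)))" for n z
    proof (induction n arbitrary: z)
      case 0
      have "u z \<le> ereal (L (max (norm z) \<eta>))"
        by (rule coarse) simp
      also have "L (max (norm z) \<eta>) \<le> A2 * sqrt (max (norm z) \<eta>)"
        by (rule A2) simp
      also have "\<dots> \<le> A * sqrt (max (norm z) \<eta>)"
        using A1 \<eta> by (intro mult_right_mono) auto
      finally show ?case by simp
    next
      case (Suc n)
      have "\<eta> / 2 ^ n \<le> \<eta>"
        using \<eta> by (simp add: field_simps)
      then have "K * (\<eta> / 2 ^ n) \<le> K * \<eta>"
        using K by (intro mult_left_mono) auto
      then have "K * (\<eta> / 2 ^ n) \<le> 1 / 2"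
        using \<eta> by linarith
      moreover have "u w \<le> ereal B" if "norm w \<le> 1 + D" for w
        unfolding B_def by (rule coarse[OF that])
      ultimately have "u z \<le> ereal (A * sqrt (max (norm z) (\<eta> / 2 ^ n / 2)))"
        using \<eta> cone assms B0
        by (intro Lelong_class_sqrt_halving[OF u V v _ \<rho> _ _ _ K A1(1) _ _ Suc]) auto
      then show ?case
        by (simp add: mult.commute)
    qed
    show ?thesis
    proof (rule LIMSEQ_le_const)
      have "(\<lambda>n. A * sqrt (max (norm w) (\<eta> * (1/2) ^ n))) \<longlonglongrightarrow> A * sqrt (max (norm w) (\<eta> * 0))"
        by (intro tendsto_intros LIMSEQ_power_zero) auto
      then show "(\<lambda>n. ereal (A * sqrt (max (norm w) (\<eta> / 2 ^ n)))) \<longlonglongrightarrow> ereal (A * sqrt (norm w))"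
        by (simp add: power_divide)
      show "\<exists>N. \<forall>n\<ge>N. u w \<le> ereal (A * sqrt (max (norm w) (\<eta> / 2 ^ n)))"
        using scale by blast
    qed
  qed
  with A0 show ?thesis by blast
qed

section \<open>Convex bodies\<close>

lemma Lelong_class_affine:
  fixes u :: "complex ^ 'n \<Rightarrow> ereal"
  assumes u: "u \<in> Lelong_class" and s: "0 < s"
  shows "(\<lambda>z. u (a + s *\<^sub>R z)) \<in> Lelong_class"
proof -
  have psh: "\<And>z. u z < \<infinity>" "\<And>t. open {z. u z < t}"
    using u by (auto simp: Lelong_class_def plurisubharmonic_on_def usc_on_def)
  have "open ((\<lambda>z. a + s *\<^sub>R z) -` {z. u z < t})" for t
    by (intro open_vimage psh continuous_intros)
  then have usc: "usc_on UNIV (\<lambda>z. u (a + s *\<^sub>R z))"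
    by (simp add: usc_on_def)
  have "a + s *\<^sub>R (a' + l *s b) = (a + s *\<^sub>R a') + l *s (s *\<^sub>R b)" for a' b :: "complex ^ 'n" and l
    unfolding vec_eq_iff by (simp add: algebra_simps)
  then have lines: "subharmonic_on UNIV (\<lambda>l. u (a + s *\<^sub>R (a' + l *s b)))" for a' b
    using Lelong_class_subharmonic[OF u, of "a + s *\<^sub>R a'" "s *\<^sub>R b"] by (simp only:)
  obtain k where k: "0 \<le> k" "\<And>z. u z \<le> ereal (ln (1 + norm z) + k)"
    using Lelong_class_growth[OF u] by blast
  have "u (a + s *\<^sub>R z) \<le> ereal (max 0 (ln (norm z)) + (ln (1 + norm a + s) + k))" for z
  proof -
    define m where "m = max 1 (norm z)"
    have m: "1 \<le> m" "norm z \<le> m"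
      by (auto simp: m_def)
    have "norm (a + s *\<^sub>R z) \<le> norm a + s * norm z"
      using norm_triangle_ineq[of a "s *\<^sub>R z"] s by simp
    moreover have "s * norm z \<le> s * m"
      using m s by (intro mult_left_mono) auto
    moreover have "norm a \<le> norm a * m"
      using m mult_left_mono[of 1 m "norm a"] by simp
    ultimately have "1 + norm (a + s *\<^sub>R z) \<le> m * (1 + norm a + s)"
      using m by (simp add: algebra_simps)
    then have "ln (1 + norm (a + s *\<^sub>R z)) \<le> ln (m * (1 + norm a + s))"
      by (intro ln_mono) (auto intro: add_pos_nonneg)
    also have "\<dots> = ln m + ln (1 + norm a + s)"
      using m s by (intro ln_mult_pos) (auto intro!: add_pos_nonneg)
    also have "ln m \<le> max 0 (ln (norm z))"
      by (simp add: m_def max_def)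
    finally have "ln (1 + norm (a + s *\<^sub>R z)) + k \<le> max 0 (ln (norm z)) + (ln (1 + norm a + s) + k)"
      by simp
    then show ?thesis
      using k(2) order_trans ereal_less_eq(3) by blast
  qed
  then show ?thesis
    unfolding Lelong_class_def plurisubharmonic_on_def using psh(1) usc lines by auto
qed

text \<open>By convexity \<open>F\<close> contains, for every \<open>a \<in> F\<close>, the cone with vertex \<open>a\<close> over the \<open>V\<close>-ball of
  radius \<open>\<rho>\<close> around \<open>c\<close>.  Shrinking it by the factor \<open>s = r / (D + \<rho>)\<close> puts it into the ball of
  radius \<open>r\<close> around \<open>a\<close> as well.  In the coordinate \<open>(z - a) / s\<close> the cone has the fixed size of the
  previous estimate, and the bound \<open>sqrt (\<delta> / s)\<close> is a multiple of \<open>sqrt \<delta> / sqrt r\<close>.\<close>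

lemma convex_local_Holder:
  fixes F :: "(complex ^ 'n) set"
  assumes F: "compact F" "convex F" and V: "real_spanning V" and \<rho>: "0 < \<rho>"
    and ball: "\<And>p. p \<in> V \<Longrightarrow> norm p \<le> \<rho> \<Longrightarrow> c + p \<in> F"
  shows "local_Holder_continuity_property (1/2) (1/2) F"
proof -
  obtain D0 where D0: "\<And>a. a \<in> F \<Longrightarrow> norm a \<le> D0"
    using compact_imp_bounded[OF F(1)] unfolding bounded_iff by blast
  define D where "D = max 1 (norm c + D0)"
  have D: "1 \<le> D" by (simp add: D_def)
  have vD: "norm (c - a) \<le> D" if "a \<in> F" for a
    using norm_triangle_ineq4[of c a] D0[OF that] by (simp add: D_def)
  obtain A where A: "0 < A" and est: "\<And>(u :: complex ^ 'n \<Rightarrow> ereal) V v w.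
      u \<in> Lelong_class \<Longrightarrow> real_spanning V \<Longrightarrow> norm v \<le> D \<Longrightarrow>
      (\<forall>\<tau> p. 0 \<le> \<tau> \<longrightarrow> \<tau> \<le> 1 \<longrightarrow> p \<in> V \<longrightarrow> norm p \<le> \<rho> \<longrightarrow> u (\<tau> *\<^sub>R (v + p)) \<le> 0) \<Longrightarrow>
      u w \<le> ereal (A * sqrt (norm w))"
    using Lelong_class_le_sqrt_cone[OF D \<rho>] by blast
  define C where "C = A * sqrt (D + \<rho>)"
  have "extremal_modulus (F \<inter> cball a r) a \<delta> \<le> ereal (C * \<delta> powr (1/2) / r powr (1/2))"
    if a: "a \<in> F" and \<delta>: "0 < \<delta>" and r: "0 < r" "r \<le> 1" for a \<delta> r
    unfolding extremal_modulus_def extremal_fun_def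
  proof (intro SUP_least)
    fix z u assume "z \<in> {z. norm (z - a) \<le> \<delta>}" "u \<in> {u \<in> Lelong_class. \<forall>w\<in>F \<inter> cball a r. u w \<le> 0}"
    then have z: "norm (z - a) \<le> \<delta>" and u: "u \<in> Lelong_class" "\<And>w. w \<in> F \<Longrightarrow> norm (w - a) \<le> r \<Longrightarrow> u w \<le> 0"
      by (auto simp: dist_norm norm_minus_commute)
    define s where "s = r / (D + \<rho>)"
    have s: "0 < s" "s \<le> 1" "s * (D + \<rho>) = r"
      using r D \<rho> by (auto simp: s_def)
    define w where "w = (1 / s) *\<^sub>R (z - a)"
    have "u (a + s *\<^sub>R w) \<le> ereal (A * sqrt (norm w))"
    proof (rule est[OF Lelong_class_affine[OF u(1) s(1)] V vD[OF a]], intro allI impI)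
      fix \<tau> :: real and p assume \<tau>: "0 \<le> \<tau>" "\<tau> \<le> 1" and p: "p \<in> V" "norm p \<le> \<rho>"
      have st: "0 \<le> s * \<tau>" "s * \<tau> \<le> 1"
        using s \<tau> mult_mono[of s 1 \<tau> 1] by auto
      have "(1 - s * \<tau>) *\<^sub>R a + (s * \<tau>) *\<^sub>R (c + p) \<in> F"
        using st ball[OF p] a by (intro convexD[OF F(2)]) auto
      moreover have "(1 - s * \<tau>) *\<^sub>R a + (s * \<tau>) *\<^sub>R (c + p) = a + s *\<^sub>R (\<tau> *\<^sub>R (c - a + p))"
        by (simp add: algebra_simps)
      moreover have "norm (s *\<^sub>R (\<tau> *\<^sub>R (c - a + p))) \<le> r"
      proof -
        have "norm (c - a + p) \<le> D + \<rho>"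
          using norm_triangle_ineq[of "c - a" p] vD[OF a] p by simp
        then have "\<tau> * norm (c - a + p) \<le> 1 * (D + \<rho>)"
          using \<tau> by (intro mult_mono) auto
        then have "s * (\<tau> * norm (c - a + p)) \<le> s * (D + \<rho>)"
          using s by (intro mult_left_mono) auto
        then show ?thesis
          using s \<tau> by simp
      qed
      ultimately show "u (a + s *\<^sub>R (\<tau> *\<^sub>R (c - a + p))) \<le> 0"
        by (intro u(2)) auto
    qed
    also have "a + s *\<^sub>R w = z"
      using s by (simp add: w_def)
    also have "A * sqrt (norm w) \<le> C * \<delta> powr (1/2) / r powr (1/2)"
    proof -
      have "norm w = norm (z - a) * ((D + \<rho>) / r)"
        using s r D \<rho> by (simp add: w_def s_def)
      also have "\<dots> \<le> \<delta> * ((D + \<rho>) / r)"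
        using z r D \<rho> by (intro mult_right_mono) auto
      finally have "sqrt (norm w) \<le> sqrt (\<delta> * ((D + \<rho>) / r))"
        by simp
      then have "A * sqrt (norm w) \<le> A * sqrt (\<delta> * ((D + \<rho>) / r))"
        using A by (intro mult_left_mono) auto
      then show ?thesis
        using \<delta> r by (simp add: C_def powr_half_sqrt real_sqrt_mult real_sqrt_divide mult_ac)
    qed
    finally show "u z \<le> ereal (C * \<delta> powr (1/2) / r powr (1/2))"
      by simp
  qed
  moreover have "0 < C"
    using A D \<rho> by (simp add: C_def)
  ultimately show ?thesis
    unfolding local_Holder_continuity_property_def using F(1) by (intro conjI exI[of _ C]) auto
qed

lemma linear_complexify: "linear complexify"
proof (rule linearI)
  fix r :: real and x y :: "real ^ 'n"
  show "complexify (x + y) = complexify x + complexify y" "complexify (r *\<^sub>R x) = r *\<^sub>R complexify x"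
    unfolding complexify_def vec_eq_iff by (simp, simp, simp add: scaleR_conv_of_real)
qed

lemma norm_complexify: "norm (complexify x) = norm x"
  by (simp add: complexify_def norm_vec_def)

lemma real_spanning_range_complexify: "real_spanning (range complexify)"
  unfolding real_spanning_def
proof (intro conjI allI)
  show "subspace (range complexify :: (complex ^ 'n) set)"
    by (intro linear_subspace_image linear_complexify subspace_UNIV)
  fix w :: "complex ^ 'n"
  define x y where "x = (\<chi> i. Re (w $ i))" and "y = (\<chi> i. Im (w $ i))"
  have "w = complexify x + \<i> *s complexify y"
    by (simp add: complexify_def vec_eq_iff x_def y_def complex_eq_iff)
  moreover have "norm x \<le> norm w" "norm y \<le> norm w"
    unfolding norm_vec_def x_def y_def
    by (auto intro!: L2_set_mono abs_Re_le_cmod abs_Im_le_cmod)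
  ultimately show "\<exists>x\<in>range complexify. \<exists>y\<in>range complexify.
      w = x + \<i> *s y \<and> norm x \<le> norm w \<and> norm y \<le> norm w"
    by (intro bexI[of _ "complexify x"] bexI[of _ "complexify y"]) (auto simp: norm_complexify)
qed

lemma real_spanning_UNIV: "real_spanning UNIV"
  unfolding real_spanning_def
proof (intro conjI allI subspace_UNIV)
  fix w :: "complex ^ 'n"
  show "\<exists>x\<in>UNIV. \<exists>y\<in>UNIV. w = x + \<i> *s y \<and> norm x \<le> norm w \<and> norm y \<le> norm w"
    by (intro bexI[of _ w] bexI[of _ 0]) auto
qed

theorem corollary1p9:
  shows "(\<forall>K :: (real ^ 'n) set.
            convex K \<and> compact K \<and> interior K \<noteq> {} \<longrightarrow>
            local_Holder_continuity_property (1/2) (1/2) (complexify ` K)) \<and>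
         (\<forall>K :: (complex ^ 'n) set.
            convex K \<and> compact K \<and> interior K \<noteq> {} \<longrightarrow>
            local_Holder_continuity_property (1/2) (1/2) K)"
proof (intro conjI allI impI)
  fix K :: "(real ^ 'n) set"
  assume K: "convex K \<and> compact K \<and> interior K \<noteq> {}"
  then obtain c \<rho> where c: "0 < \<rho>" "cball c \<rho> \<subseteq> K"
    using mem_interior_cball by blast
  show "local_Holder_continuity_property (1/2) (1/2) (complexify ` K)"
  proof (rule convex_local_Holder[OF _ _ real_spanning_range_complexify c(1), of _ "complexify c"])
    show "compact (complexify ` K)"
      using K by (intro compact_continuous_image linear_continuous_on linear_conv_bounded_linear[THEN iffD1] linear_complexify) auto
    show "convex (complexify ` K)"
      using K by (intro convex_linear_image linear_complexify) auto
    fix p :: "complex ^ 'n"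
    assume "p \<in> range complexify" "norm p \<le> \<rho>"
    then obtain q where q: "p = complexify q" "norm q \<le> \<rho>"
      by (auto simp: norm_complexify)
    then have "c + q \<in> K"
      using c(2) by (auto simp: dist_norm)
    then show "complexify c + p \<in> complexify ` K"
      unfolding q(1) linear_add[OF linear_complexify, symmetric] by (rule imageI)
  qed
next
  fix K :: "(complex ^ 'n) set"
  assume K: "convex K \<and> compact K \<and> interior K \<noteq> {}"
  then obtain c \<rho> where c: "0 < \<rho>" "cball c \<rho> \<subseteq> K"
    using mem_interior_cball by blast
  show "local_Holder_continuity_property (1/2) (1/2) K"
    by (rule convex_local_Holder[OF _ _ real_spanning_UNIV c(1), of K c]) (use K c(2) in \<open>auto intro!: subsetD[OF c(2)] simp: dist_norm\<close>)
qed

end
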